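(* Let $r\in\mathbb{N}$. For any $m_1,\ldots,m_r\in \mathbb{N}$, with $m=\operatorname{lcm}[m_1,\ldots,m_r]$, $$A(m_1,\ldots,m_r)= \frac1{m} \sum_{d\mid m} \gcd(d,m_1) \cdots \gcd(d,m_r)\, \phi(m/d).$$
   Context: $\mathbb{N}=\{1,2,\ldots\}$. $\phi$ is Euler's totient function. The function $A$ is defined by $A(m_1,\ldots,m_r)=\frac1{m}\sum_{k=1}^m\gcd(k,m_1)\cdots\gcd(k,m_r)$ with $m=\operatorname{lcm}[m_1,\ldots,m_r]$. The sum in the claim is over positive divisors $d$ of $m$. *)

theory Defs
  imports Complex_Main "HOL-Number_Theory.Totient"
begin

text \<open>
  A tuple \<open>(m\<^sub>1, \<dots>, m\<^sub>r)\<close> is a function \<open>m\<close> on \<open>nat\<close> together with its length \<open>r\<close>;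
  only the values of \<open>m\<close> on \<open>{1..r}\<close> are used.
\<close>

definition avg_gcd_prod :: "nat \<Rightarrow> (nat \<Rightarrow> nat) \<Rightarrow> real" where
  "avg_gcd_prod r m =
    (let M = (LCM i\<in>{1..r}. m i)
     in 1 / real M * (\<Sum>k = 1..M. \<Prod>i = 1..r. real (gcd k (m i))))"

end

(* Group the summation index k by d = gcd(k, M): since every m i divides M, gcd(k, m i) depends
   only on d, and each d dividing M arises from totient (M / d) values of k. *)
theory Submission
  imports Defs
begin

text \<open>Since each \<open>m i\<close> divides \<open>M\<close>,
  \<open>gcd k (m i) = gcd (gcd k M) (m i)\<close>, so the summand is a function of
  \<open>gcd k M\<close> alone. Cesaro's formula, \<open>sum_gcd_eq_sum_divisors_totient\<close>,
  then turns the sum over \<open>k\<close> into a sum over divisors weighted by totients.\<close>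

lemma sum_gcd_eq_sum_divisors_totient:
  fixes f :: "nat \<Rightarrow> 'a::comm_semiring_1"
  assumes "n > 0"
  shows "(\<Sum>k = 1..n. f (gcd k n)) = (\<Sum>d | d dvd n. f d * of_nat (totient (n div d)))"
proof -
  have "(\<Sum>k = 1..n. f (gcd k n)) = (\<Sum>k\<in>{0<..n}. f (gcd k n))"
    by (rule sum.cong) auto
  \<comment> \<open>Partition into the fibres of \<open>gcd k n\<close>; \<open>n > 0\<close> makes
    the set of divisors finite.\<close>
  also have "\<dots> = (\<Sum>d | d dvd n. \<Sum>k | k \<in> {0<..n} \<and> gcd k n = d. f (gcd k n))"
    using assms by (intro sum.group [symmetric]) auto
  also have "\<dots> = (\<Sum>d | d dvd n. f d * of_nat (totient (n div d)))"
  proof (rule sum.cong)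
    fix d assume "d \<in> {d. d dvd n}"
    \<comment> \<open>The fibre over \<open>d\<close> consists of the \<open>k = d * j\<close> with
      \<open>j\<close> in \<open>{0<..n div d}\<close> coprime to \<open>n div d\<close>.\<close>
    then have "card {k \<in> {0<..n}. gcd k n = d} = totient (n div d)"
      using assms by (intro card_gcd_eq_totient) auto
    moreover have "(\<Sum>k | k \<in> {0<..n} \<and> gcd k n = d. f (gcd k n))
        = (\<Sum>k | k \<in> {0<..n} \<and> gcd k n = d. f d)"
      by (rule sum.cong) auto
    ultimately show "(\<Sum>k | k \<in> {0<..n} \<and> gcd k n = d. f (gcd k n))
        = f d * of_nat (totient (n div d))"
      by (simp add: mult.commute)
  qed simp
  finally show ?thesis .
qed

theorem proposition14:
  fixes r M :: nat and m :: "nat \<Rightarrow> nat"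
  assumes "r \<ge> 1"
    and "\<And>i. i \<in> {1..r} \<Longrightarrow> m i \<ge> 1"
    and "M = (LCM i\<in>{1..r}. m i)"
  shows "avg_gcd_prod r m =
    1 / real M * (\<Sum>d | d dvd M. (\<Prod>i = 1..r. real (gcd d (m i))) * real (totient (M div d)))"
proof -
  \<comment> \<open>A finite LCM vanishes only if some entry does.\<close>
  have "0 \<notin> m ` {1..r}"
    using assms(2) by fastforce
  then have "M > 0"
    unfolding assms(3) by (intro gr_zeroI) (simp add: Lcm_0_iff)
  have dvd: "m i dvd M" if "i \<in> {1..r}" for i
    using that unfolding assms(3) by (intro dvd_Lcm imageI)
  have gcd_gcd: "gcd (gcd k M) (m i) = gcd k (m i)" if "i \<in> {1..r}" for i k
    using dvd [OF that] by (simp add: gcd.assoc gcd_proj2_if_dvd)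
  have "(\<Sum>k = 1..M. \<Prod>i = 1..r. real (gcd k (m i)))
      = (\<Sum>k = 1..M. \<Prod>i = 1..r. real (gcd (gcd k M) (m i)))"
    by (intro sum.cong prod.cong) (simp_all only: gcd_gcd)
  \<comment> \<open>Cesaro's formula with \<open>f d\<close> the product of the
    \<open>gcd d (m i)\<close>.\<close>
  also have "\<dots> = (\<Sum>d | d dvd M. (\<Prod>i = 1..r. real (gcd d (m i))) * real (totient (M div d)))"
    using \<open>M > 0\<close> by (rule sum_gcd_eq_sum_divisors_totient)
  finally show ?thesis
    by (simp only: avg_gcd_prod_def Let_def assms(3) [symmetric])
qed

end
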